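(* Let $c\in\mathbb{R}^n$ with $\Pi_{\mathcal{A}_0}c\neq0$. The Lagrangian system on $\mathcal{A}_0\times\Pi_{\mathcal{A}_0}\mathcal{F}$ associated with $$\mathcal{L}:\mathcal{A}_0\times\Pi_{\mathcal{A}_0}\mathcal{F}\to\mathbb{R},\qquad\mathcal{L}(q,\dot q)=\langle\Pi_{\mathcal{A}_0}c,q\rangle-h(\Pi_{\mathcal{A}}\dot q),$$ gives rise, by the Legendre transform, to a completely integrable Hamiltonian system on $\mathcal{A}_0\times\mathcal{F}^*$ with Hamiltonian $\mathcal{H}:\mathcal{A}_0\times\mathcal{F}^*\to\mathbb{R}$ given by $$\mathcal{H}(q,p)=\big\langle p,[\phi_h\circ\Pi_{\mathcal{A}}]^{-1}(p)\big\rangle-\mathcal{L}\big(q,[\phi_h\circ\Pi_{\mathcal{A}}]^{-1}(p)\big).$$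
   Context: Let $m<n$ be positive integers, $A\in\mathbb{R}^{m\times n}$ of full rank, $b\in\operatorname{Im}A$, $\mathcal{A}=\{x\in\mathbb{R}^n: Ax=b\}$, $\mathcal{A}_0=\ker A$, $r=n-m=\dim\mathcal{A}_0$. Let $C\subset\mathbb{R}^n$ be nonempty, open and convex, with $\mathcal{F}=C\cap\mathcal{A}\neq\emptyset$. $\Pi_{\mathcal{A}_0}$ is the Euclidean orthogonal projection onto $\mathcal{A}_0$, and $\Pi_{\mathcal{A}}$ is the orthogonal projection onto $\mathcal{A}$, i.e. $\Pi_{\mathcal{A}}x=\widetilde x+\Pi_{\mathcal{A}_0}(x-\widetilde x)$ for any $\widetilde x\in\mathcal{A}$. $\Gamma_0(\mathbb{R}^n)$ is the set of lower semicontinuous proper convex functions $\mathbb{R}^n\to\mathbb{R}\cup\{+\infty\}$. A function $h\in\Gamma_0(\mathbb{R}^n)$ is of Legendre type if it is differentiable on $\operatorname{int}\operatorname{dom}h$, $|\nabla h(x^j)|\to+\infty$ for every sequence $(x^j)\subset\operatorname{int}\operatorname{dom}h$ converging to a boundary point of $\operatorname{dom}h$, and $h$ is strictly convex on $\operatorname{int}\operatorname{dom}h$. The function $h\in\Gamma_0(\mathbb{R}^n)$ is assumed to satisfy: (i) $h$ is of Legendre type with $\operatorname{int}\operatorname{dom}h=C$; (ii) $h_{|C}\in\mathcal{C}^2(C;\mathbb{R})$ and $\nabla^2h(x)$ is symmetric positive definite for all $x\in C$; (iii) $x\mapsto\nabla^2h(x)$ is locally Lipschitz continuous on $C$. All mappings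 are supposed to be at least of class $\mathcal{C}^2$. The Legendre transform coordinates mapping is $\phi_h:\mathcal{F}\to\mathcal{F}^*=\phi_h(\mathcal{F})\subset\mathcal{A}_0$, $\phi_h(x)=\Pi_{\mathcal{A}_0}\nabla h(x)$; it is a diffeomorphism onto $\mathcal{F}^*$, and $\phi_h\circ\Pi_{\mathcal{A}}$ is regarded as a map from $\Pi_{\mathcal{A}_0}\mathcal{F}$ to $\mathcal{F}^*$. $\mathcal{A}_0$ carries a linear system of coordinates $(q_1,\dots,q_r)$ induced by a Euclidean orthonormal basis, and is thereby identified with $\mathbb{R}^r$. The Lagrangian system is $\frac{d}{dt}\frac{\partial\mathcal{L}}{\partial\dot q_i}=\frac{\partial\mathcal{L}}{\partial q_i}$, $\frac{d}{dt}q_i=\dot q_i$, $i=1,\dots,r$. The Legendre transform associated with a Lagrangian is $\Phi(q,\dot q)=(q,\frac{\partial\mathcal{L}}{\partial\dot q}(q,\dot q))$; here it is given as $\Phi:\mathcal{A}_0\times\Pi_{\mathcal{A}_0}\mathcal{F}\to\mathcal{A}_0\times\mathcal{F}^*$, $(q,\dot q)\mapsto(q,[\phi_h\circ\Pi_{\mathcal{A}}](\dot q))$. When $\Phi$ is a diffeomorphism, writing $\Phi^{-1}(q,p)=(q,\psi^{-1}(q,p))$, the Hamiltonian associated with $\mathcal{L}$ is $\mathcal{H}(q,p)=\langle p,\psi^{-1}(q,p)\rangle-\mathcal{L}(q,\psi^{-1}(q,p))$, and $\Phi$ sends the trajectories of the Lagrangian system to the trajectories of the Hamiltonian system $\dot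 p_i=-\frac{\partial\mathcal{H}}{\partial q_i}$, $\dot q_i=\frac{\partial\mathcal{H}}{\partial p_i}$, $i=1,\dots,r$. The Poisson bracket is $\{f_1,f_2\}=\sum_{i=1}^r\frac{\partial f_1}{\partial p_i}\frac{\partial f_2}{\partial q_i}-\frac{\partial f_1}{\partial q_i}\frac{\partial f_2}{\partial p_i}$. The Hamiltonian system is completely integrable if there exist $r$ functions $f_1,\dots,f_r$ on the phase space with $f_1=\mathcal{H}$ such that $\{f_i,f_j\}=0$ for all $i,j=1,\dots,r$ and $df_1,\dots,df_r$ are linearly independent at every point of the phase space.
   Formalization: The Legendre transform of L is (q, −φ_h∘Π_A(q̇)), so the printed Φ and H do not match L's trajectories; integrability is proved for the printed H on A_0×F*, but trajectory correspondence only for the sign-corrected Φ and H on A_0×(−F* ). *)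

theory Defs
  imports "HOL-Analysis.Analysis"
begin

section \<open>Differential calculus on open sets\<close>

definition gradient :: "('a::euclidean_space \<Rightarrow> real) \<Rightarrow> 'a \<Rightarrow> 'a" where
  "gradient f x = (THE D. GDERIV f x :> D)"

definition hessian :: "(real^'n \<Rightarrow> real) \<Rightarrow> real^'n \<Rightarrow> real^'n^'n" where
  "hessian f x = matrix (frechet_derivative (gradient f) (at x))"

text \<open>Class \<open>C\<^sup>k\<close> on a set, which is meant to be open: all iterated directional derivatives of
  order up to \<open>k\<close> exist as Frechet derivatives and are continuous.\<close>

primrec Ck_on :: "nat \<Rightarrow> ('a::euclidean_space \<Rightarrow> 'b::real_normed_vector) \<Rightarrow> 'a set \<Rightarrow> bool" where
  "Ck_on 0 f S \<longleftrightarrow> continuous_on S f"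
| "Ck_on (Suc k) f S \<longleftrightarrow>
     (\<forall>x\<in>S. f differentiable (at x)) \<and> (\<forall>v. Ck_on k (\<lambda>x. frechet_derivative f (at x) v) S)"

definition diffeo ::
  "nat \<Rightarrow> ('a::euclidean_space \<Rightarrow> 'b::euclidean_space) \<Rightarrow> 'a set \<Rightarrow> 'b set \<Rightarrow> bool" where
  "diffeo k f M N \<longleftrightarrow>
     open M \<and> open N \<and> bij_betw f M N \<and> Ck_on k f M \<and> Ck_on k (inv_into M f) N"


section \<open>Functions of Legendre type\<close>

definition effdom :: "('a \<Rightarrow> ereal) \<Rightarrow> 'a set" where
  "effdom h = {x. h x < \<infinity>}"

definition Gamma0 :: "('a::euclidean_space \<Rightarrow> ereal) \<Rightarrow> bool" where
  "Gamma0 h \<longleftrightarrow>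
     (\<forall>x. h x \<noteq> -\<infinity>) \<and> effdom h \<noteq> {} \<and>
     (\<forall>x. h x \<le> Liminf (at x) h) \<and>
     (\<forall>x y t. 0 < t \<and> t < 1 \<longrightarrow>
        h ((1 - t) *\<^sub>R x + t *\<^sub>R y) \<le> ereal (1 - t) * h x + ereal t * h y)"

abbreviation real_part :: "('a \<Rightarrow> ereal) \<Rightarrow> 'a \<Rightarrow> real" where
  "real_part h \<equiv> (\<lambda>x. real_of_ereal (h x))"

definition legendre_type :: "('a::euclidean_space \<Rightarrow> ereal) \<Rightarrow> bool" where
  "legendre_type h \<longleftrightarrow>
     Gamma0 h \<and>
     (\<forall>x\<in>interior (effdom h). real_part h differentiable (at x)) \<and>
     (\<forall>X l. (\<forall>j. X j \<in> interior (effdom h)) \<and> X \<longlonglongrightarrow> l \<and> l \<in> frontier (effdom h) \<longrightarrow>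
        filterlim (\<lambda>j. norm (gradient (real_part h) (X j))) at_top sequentially) \<and>
     (\<forall>x\<in>interior (effdom h). \<forall>y\<in>interior (effdom h). \<forall>t. x \<noteq> y \<and> 0 < t \<and> t < 1 \<longrightarrow>
        h ((1 - t) *\<^sub>R x + t *\<^sub>R y) < ereal (1 - t) * h x + ereal t * h y)"

definition admissible_barrier :: "(real^'n) set \<Rightarrow> (real^'n \<Rightarrow> ereal) \<Rightarrow> bool" where
  "admissible_barrier C h \<longleftrightarrow>
     legendre_type h \<and> interior (effdom h) = C \<and>
     Ck_on 2 (real_part h) C \<and>
     (\<forall>x\<in>C. transpose (hessian (real_part h) x) = hessian (real_part h) x \<and>
        (\<forall>v. v \<noteq> 0 \<longrightarrow> 0 < v \<bullet> (hessian (real_part h) x *v v))) \<and>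
     (\<forall>x\<in>C. \<exists>\<epsilon>>0. \<exists>K. K-lipschitz_on (ball x \<epsilon> \<inter> C) (hessian (real_part h)))"


section \<open>The affine constraint and the Legendre transform coordinates\<close>

definition ker_of :: "real^'n^'m \<Rightarrow> (real^'n) set" where
  "ker_of A = {x. A *v x = 0}"

definition aff_of :: "real^'n^'m \<Rightarrow> real^'m \<Rightarrow> (real^'n) set" where
  "aff_of A b = {x. A *v x = b}"

text \<open>The Euclidean orthogonal projection onto a nonempty closed affine subspace \<open>S\<close> is the
  nearest-point map \<open>closest_point S\<close>.\<close>

abbreviation proj_ker :: "real^'n^'m \<Rightarrow> real^'n \<Rightarrow> real^'n" where
  "proj_ker A \<equiv> closest_point (ker_of A)"

abbreviation proj_aff :: "real^'n^'m \<Rightarrow> real^'m \<Rightarrow> real^'n \<Rightarrow> real^'n" where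
  "proj_aff A b \<equiv> closest_point (aff_of A b)"

definition feas :: "real^'n^'m \<Rightarrow> real^'m \<Rightarrow> (real^'n) set \<Rightarrow> (real^'n) set" where
  "feas A b C = C \<inter> aff_of A b"

definition leg_coord :: "real^'n^'m \<Rightarrow> (real^'n \<Rightarrow> ereal) \<Rightarrow> real^'n \<Rightarrow> real^'n" where
  "leg_coord A h x = proj_ker A (gradient (real_part h) x)"

definition feas_dual ::
  "real^'n^'m \<Rightarrow> real^'m \<Rightarrow> (real^'n) set \<Rightarrow> (real^'n \<Rightarrow> ereal) \<Rightarrow> (real^'n) set" where
  "feas_dual A b C h = leg_coord A h ` feas A b C"

definition feas_dir :: "real^'n^'m \<Rightarrow> real^'m \<Rightarrow> (real^'n) set \<Rightarrow> (real^'n) set" where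
  "feas_dir A b C = proj_ker A ` feas A b C"

definition phi_proj ::
  "real^'n^'m \<Rightarrow> real^'m \<Rightarrow> (real^'n \<Rightarrow> ereal) \<Rightarrow> real^'n \<Rightarrow> real^'n" where
  "phi_proj A b h = leg_coord A h \<circ> proj_aff A b"

definition phi_proj_inv ::
  "real^'n^'m \<Rightarrow> real^'m \<Rightarrow> (real^'n) set \<Rightarrow> (real^'n \<Rightarrow> ereal) \<Rightarrow> real^'n \<Rightarrow> real^'n" where
  "phi_proj_inv A b C h = inv_into (feas_dir A b C) (phi_proj A b h)"

definition Lagr ::
  "real^'n^'m \<Rightarrow> real^'m \<Rightarrow> (real^'n \<Rightarrow> ereal) \<Rightarrow> real^'n \<Rightarrow> (real^'n) \<times> (real^'n) \<Rightarrow> real" where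
  "Lagr A b h c = (\<lambda>(q, v). proj_ker A c \<bullet> q - real_part h (proj_aff A b v))"

definition Ham ::
  "real^'n^'m \<Rightarrow> real^'m \<Rightarrow> (real^'n) set \<Rightarrow> (real^'n \<Rightarrow> ereal) \<Rightarrow> real^'n
     \<Rightarrow> (real^'n) \<times> (real^'n) \<Rightarrow> real" where
  "Ham A b C h c =
     (\<lambda>(q, p). p \<bullet> phi_proj_inv A b C h p - Lagr A b h c (q, phi_proj_inv A b C h p))"

definition Leg_map ::
  "real^'n^'m \<Rightarrow> real^'m \<Rightarrow> (real^'n \<Rightarrow> ereal)
     \<Rightarrow> (real^'n) \<times> (real^'n) \<Rightarrow> (real^'n) \<times> (real^'n)" where
  "Leg_map A b h = (\<lambda>(q, v). (q, phi_proj A b h v))"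


section \<open>Orthonormal coordinates on a subspace\<close>

definition orthonormal_basis_of :: "('r::finite \<Rightarrow> real^'n) \<Rightarrow> (real^'n) set \<Rightarrow> bool" where
  "orthonormal_basis_of e S \<longleftrightarrow>
     (\<forall>i j. e i \<bullet> e j = (if i = j then 1 else 0)) \<and> span (range e) = S"

text \<open>Coordinates on \<open>S \<times> S\<close> for an orthonormal basis \<open>e\<close> of \<open>S\<close>: a set \<open>U\<close>, a function \<open>f\<close> and
  a map \<open>F\<close> on \<open>S \<times> S\<close> read \<open>from_coords e -` U\<close>, \<open>f \<circ> from_coords e\<close> and
  \<open>to_coords e \<circ> F \<circ> from_coords e\<close> in coordinates.\<close>

definition from_coords ::
  "('r::finite \<Rightarrow> real^'n) \<Rightarrow> (real^'r) \<times> (real^'r) \<Rightarrow> (real^'n) \<times> (real^'n)" where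
  "from_coords e = (\<lambda>(q, p). (\<Sum>i\<in>UNIV. q $ i *\<^sub>R e i, \<Sum>i\<in>UNIV. p $ i *\<^sub>R e i))"

definition to_coords ::
  "('r::finite \<Rightarrow> real^'n) \<Rightarrow> (real^'n) \<times> (real^'n) \<Rightarrow> (real^'r) \<times> (real^'r)" where
  "to_coords e = (\<lambda>(x, y). (\<chi> i. x \<bullet> e i, \<chi> i. y \<bullet> e i))"


section \<open>Lagrangian and Hamiltonian systems in coordinates\<close>

type_synonym 'r phase = "(real^'r) \<times> (real^'r)"

text \<open>Partial derivative with respect to the \<open>i\<close>-th coordinate of the first and of the second
  component.\<close>

definition partial1 :: "('r::finite phase \<Rightarrow> real) \<Rightarrow> 'r \<Rightarrow> 'r phase \<Rightarrow> real" where
  "partial1 f i z = deriv (\<lambda>t. f (fst z + t *\<^sub>R axis i 1, snd z)) 0"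

definition partial2 :: "('r::finite phase \<Rightarrow> real) \<Rightarrow> 'r \<Rightarrow> 'r phase \<Rightarrow> real" where
  "partial2 f i z = deriv (\<lambda>t. f (fst z, snd z + t *\<^sub>R axis i 1)) 0"

definition lagrangian_trajectory ::
  "('r::finite phase \<Rightarrow> real) \<Rightarrow> real set \<Rightarrow> (real \<Rightarrow> 'r phase) \<Rightarrow> bool" where
  "lagrangian_trajectory L T \<gamma> \<longleftrightarrow>
     (\<forall>t\<in>T. \<forall>i.
        ((\<lambda>s. partial2 L i (\<gamma> s)) has_real_derivative partial1 L i (\<gamma> t)) (at t) \<and>
        ((\<lambda>s. fst (\<gamma> s) $ i) has_real_derivative snd (\<gamma> t) $ i) (at t))"

definition hamiltonian_trajectory ::
  "('r::finite phase \<Rightarrow> real) \<Rightarrow> real set \<Rightarrow> (real \<Rightarrow> 'r phase) \<Rightarrow> bool" where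
  "hamiltonian_trajectory H T \<gamma> \<longleftrightarrow>
     (\<forall>t\<in>T. \<forall>i.
        ((\<lambda>s. snd (\<gamma> s) $ i) has_real_derivative - partial1 H i (\<gamma> t)) (at t) \<and>
        ((\<lambda>s. fst (\<gamma> s) $ i) has_real_derivative partial2 H i (\<gamma> t)) (at t))"

definition legendre_transform :: "('r::finite phase \<Rightarrow> real) \<Rightarrow> 'r phase \<Rightarrow> 'r phase" where
  "legendre_transform L = (\<lambda>(q, v). (q, \<chi> i. partial2 L i (q, v)))"

text \<open>The Hamiltonian obtained from \<open>L\<close> through a diffeomorphism \<open>\<Phi>\<close> of \<open>M\<close> of the form
  \<open>\<Phi> (q, v) = (q, \<psi> (q, v))\<close>.\<close>

definition hamiltonian_via ::
  "('r::finite phase \<Rightarrow> 'r phase) \<Rightarrow> 'r phase set \<Rightarrow> ('r phase \<Rightarrow> real) \<Rightarrow> 'r phase \<Rightarrow> real" where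
  "hamiltonian_via \<Phi> M L =
     (\<lambda>(q, p). p \<bullet> snd (inv_into M \<Phi> (q, p)) - L (q, snd (inv_into M \<Phi> (q, p))))"

definition poisson ::
  "('r::finite phase \<Rightarrow> real) \<Rightarrow> ('r phase \<Rightarrow> real) \<Rightarrow> 'r phase \<Rightarrow> real" where
  "poisson f g z =
     (\<Sum>i\<in>UNIV. partial2 f i z * partial1 g i z - partial1 f i z * partial2 g i z)"

text \<open>Complete integrability on the open phase space \<open>N\<close>, with first integrals \<open>f 1, \<dots>, f r\<close> of
  class \<open>C\<^sup>k\<close>.\<close>

definition completely_integrable ::
  "nat \<Rightarrow> 'r::finite phase set \<Rightarrow> ('r phase \<Rightarrow> real) \<Rightarrow> bool" where
  "completely_integrable k N H \<longleftrightarrow>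
     (\<exists>f :: nat \<Rightarrow> 'r phase \<Rightarrow> real.
        (\<forall>z\<in>N. f 1 z = H z) \<and>
        (\<forall>i\<in>{1..CARD('r)}. Ck_on k (f i) N) \<and>
        (\<forall>i\<in>{1..CARD('r)}. \<forall>j\<in>{1..CARD('r)}. \<forall>z\<in>N. poisson (f i) (f j) z = 0) \<and>
        (\<forall>z\<in>N. \<forall>a :: nat \<Rightarrow> real.
           (\<forall>w. (\<Sum>i=1..CARD('r). a i * frechet_derivative (f i) (at z) w) = 0) \<longrightarrow>
           (\<forall>i\<in>{1..CARD('r)}. a i = 0)))"

text \<open>Pitfall: signs. For \<open>L = Lagr A b h c\<close> one has \<open>\<partial>L/\<partial>v = - phi_proj A b h v\<close>. Hence the
  Legendre transform of \<open>L\<close>, taken by its definition, maps onto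
  \<open>ker_of A \<times> uminus ` feas_dual A b C h\<close>, whereas \<open>Leg_map\<close> and \<open>Ham\<close>, as they are usually
  written, use \<open>phi_proj\<close> without the minus sign and live on \<open>ker_of A \<times> feas_dual A b C h\<close>.
  \<open>Ham_L\<close> is the formula of \<open>Ham\<close> with \<open>- phi_proj\<close> in place of \<open>phi_proj\<close>.\<close>

definition Ham_L ::
  "real^'n^'m \<Rightarrow> real^'m \<Rightarrow> (real^'n) set \<Rightarrow> (real^'n \<Rightarrow> ereal) \<Rightarrow> real^'n
     \<Rightarrow> (real^'n) \<times> (real^'n) \<Rightarrow> real" where
  "Ham_L A b C h c =
     (\<lambda>(q, p). p \<bullet> phi_proj_inv A b C h (- p) - Lagr A b h c (q, phi_proj_inv A b C h (- p)))"

end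

theory Submission
  imports Defs
begin

text \<open>In orthonormal coordinates \<open>E\<close> of the kernel and with an offset \<open>a\<close> orthogonal to it, put
  \<open>G v = h (a + E v)\<close> and \<open>g = \<nabla>G\<close>. Positive definiteness of the Hessian makes \<open>g\<close> injective with
  invertible derivative, hence a diffeomorphism onto its image, and the Legendre transform of
  \<open>L (q, v) = \<kappa> \<bullet> q - G v\<close> is fibrewise \<open>- g\<close>. In either sign convention the Hamiltonian has the form
  \<open>R p - \<kappa> \<bullet> q\<close>. It commutes with every linear function \<open>u \<bullet> p\<close> of the momenta with \<open>u \<bullet> \<kappa> = 0\<close>, and
  such functions for a basis of the hyperplane orthogonal to \<open>\<kappa> \<noteq> 0\<close> complete it to \<open>r\<close>
  independent integrals.\<close>

section \<open>Calculus of functions of class \<open>C\<^sup>k\<close>\<close>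

lemma frechet_derivative_eq:
  "(f has_derivative f') (at x) \<Longrightarrow> frechet_derivative f (at x) = f'"
  using frechet_derivative_at by metis

lemma Ck_on_SucD:
  assumes "Ck_on (Suc k) f S" "x \<in> S"
  shows "(f has_derivative frechet_derivative f (at x)) (at x)"
  using assms by (simp add: frechet_derivative_works[symmetric])

text \<open>Openness of \<open>S\<close> lets the derivatives agree as well, since these depend on
  the values near a point; the induction then passes to directional derivatives.\<close>

lemma Ck_on_cong:
  assumes "open S" "Ck_on k f S" "\<And>x. x \<in> S \<Longrightarrow> f x = g x"
  shows "Ck_on k g S"
  using assms(2,3)
proof (induction k arbitrary: f g)
  case 0
  then show ?case by (simp cong: continuous_on_cong)
next
  case (Suc k)
  have der: "(g has_derivative frechet_derivative f (at x)) (at x)" if "x \<in> S" for x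
    using has_derivative_transform_within_open[OF Ck_on_SucD[OF Suc.prems(1) that] assms(1) that]
      Suc.prems(2) by blast
  have "Ck_on k (\<lambda>x. frechet_derivative g (at x) v) S" for v
    by (rule Suc.IH[of "\<lambda>x. frechet_derivative f (at x) v"])
      (use Suc.prems(1) frechet_derivative_eq[OF der] in auto)
  then show ?case using der by (auto simp: differentiable_def)
qed

text \<open>The introduction rule behind the closure results: an explicit formula \<open>f'\<close>
  stands in for \<open>frechet_derivative\<close>, so that the induction hypothesis can be applied
  to the terms of that formula.\<close>

lemma Ck_on_SucI:
  assumes "open S" "\<And>x. x \<in> S \<Longrightarrow> (f has_derivative f' x) (at x)"
    "\<And>v. Ck_on k (\<lambda>x. f' x v) S"
  shows "Ck_on (Suc k) f S"
proof -
  have "Ck_on k (\<lambda>x. frechet_derivative f (at x) v) S" for v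
    by (rule Ck_on_cong[OF assms(1) assms(3)[of v]]) (simp add: frechet_derivative_eq[OF assms(2)])
  then show ?thesis using assms(2) by (auto simp: differentiable_def)
qed

lemma Ck_on_Suc_imp: "Ck_on (Suc k) f S \<Longrightarrow> Ck_on k f S"
proof (induction k arbitrary: f)
  case 0
  then show ?case
    by (auto intro!: continuous_at_imp_continuous_on differentiable_imp_continuous_within)
next
  case (Suc k)
  then show ?case by (metis Ck_on.simps(2))
qed

lemma Ck_on_mono: "Ck_on k f S \<Longrightarrow> j \<le> k \<Longrightarrow> Ck_on j f S"
  by (induction k) (use Ck_on_Suc_imp le_Suc_eq in blast)+

section \<open>Closure under linear maps, sums, products, reciprocals and composition\<close>

lemma Ck_on_const: "open S \<Longrightarrow> Ck_on k (\<lambda>x. c) S"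
  by (induction k arbitrary: c) (auto intro!: Ck_on_SucI[where f' = "\<lambda>_ _. 0"])

lemma Ck_on_linear:
  assumes "open S" "bounded_linear l"
  shows "Ck_on k l S"
proof (cases k)
  case 0
  then show ?thesis using assms by (simp add: linear_continuous_on)
next
  case (Suc j)
  show ?thesis unfolding Suc
    by (rule Ck_on_SucI[where f' = "\<lambda>_. l"])
      (use assms in \<open>auto intro: bounded_linear_imp_has_derivative Ck_on_const\<close>)
qed

lemma Ck_on_linear_comp:
  assumes "open S" "bounded_linear l" "Ck_on k f S"
  shows "Ck_on k (\<lambda>x. l (f x)) S"
  using assms(3)
proof (induction k arbitrary: f)
  case 0
  then show ?case using assms(2) by (simp add: linear_continuous_on_compose bounded_linear.continuous_on)
next
  case (Suc k)
  show ?case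
    by (rule Ck_on_SucI[where f' = "\<lambda>x v. l (frechet_derivative f (at x) v)"])
      (use assms Suc Ck_on_SucD[OF Suc.prems] in
        \<open>auto intro!: bounded_linear.has_derivative[OF assms(2)]\<close>)
qed

lemma Ck_on_add:
  assumes "open S" "Ck_on k f S" "Ck_on k g S"
  shows "Ck_on k (\<lambda>x. f x + g x) S"
  using assms(2,3)
proof (induction k arbitrary: f g)
  case 0
  then show ?case by (simp add: continuous_on_add)
next
  case (Suc k)
  show ?case
    by (rule Ck_on_SucI[where f' = "\<lambda>x v. frechet_derivative f (at x) v + frechet_derivative g (at x) v"])
      (use assms Suc Ck_on_SucD[OF Suc.prems(1)] Ck_on_SucD[OF Suc.prems(2)] in
        \<open>auto intro!: has_derivative_add\<close>)
qed

text \<open>One induction serves scaling, products and inner products. The product rule yields two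
  terms of the same bilinear shape, each with one factor differentiated, so both functions are
  generalised.\<close>

lemma Ck_on_bilinear:
  assumes "bounded_bilinear b" "open S" "Ck_on k f S" "Ck_on k g S"
  shows "Ck_on k (\<lambda>x. b (f x) (g x)) S"
  using assms(3,4)
proof (induction k arbitrary: f g)
  case 0
  then show ?case by (simp add: bounded_bilinear.continuous_on[OF assms(1)])
next
  case (Suc k)
  show ?case
  proof (rule Ck_on_SucI)
    show "((\<lambda>x. b (f x) (g x)) has_derivative
        (\<lambda>v. b (f x) (frechet_derivative g (at x) v) + b (frechet_derivative f (at x) v) (g x)))
        (at x)" if "x \<in> S" for x
      by (rule bounded_bilinear.FDERIV[OF assms(1)]) (use Suc.prems that Ck_on_SucD in blast)+
    show "Ck_on k (\<lambda>x. b (f x) (frechet_derivative g (at x) v) +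
        b (frechet_derivative f (at x) v) (g x)) S" for v
      using Suc.prems Ck_on_Suc_imp[OF Suc.prems(1)] Ck_on_Suc_imp[OF Suc.prems(2)]
      by (intro Ck_on_add Suc.IH assms) auto
  qed fact
qed

lemmas Ck_on_scaleR = Ck_on_bilinear[OF bounded_bilinear_scaleR]
  and Ck_on_mult = Ck_on_bilinear[OF bounded_bilinear_mult]
  and Ck_on_inner = Ck_on_bilinear[OF bounded_bilinear_inner]

lemma Ck_on_sum:
  "open S \<Longrightarrow> (\<And>i. i \<in> I \<Longrightarrow> Ck_on k (f i) S) \<Longrightarrow> Ck_on k (\<lambda>x. \<Sum>i\<in>I. f i x) S"
  by (induction I rule: infinite_finite_induct) (auto intro: Ck_on_const Ck_on_add)

lemma Ck_on_prod:
  fixes f :: "'i \<Rightarrow> 'a::euclidean_space \<Rightarrow> real"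
  shows "open S \<Longrightarrow> (\<And>i. i \<in> I \<Longrightarrow> Ck_on k (f i) S) \<Longrightarrow> Ck_on k (\<lambda>x. \<Prod>i\<in>I. f i x) S"
  by (induction I rule: infinite_finite_induct) (auto intro: Ck_on_const Ck_on_mult)

text \<open>The derivative of the reciprocal is a product of the reciprocal itself and the
  derivative of \<open>f\<close>, so knowing the reciprocal to be C^k already puts its derivative in
  C^k.\<close>

lemma Ck_on_inverse:
  fixes f :: "'a::euclidean_space \<Rightarrow> real"
  assumes "open S" "Ck_on k f S" "\<And>x. x \<in> S \<Longrightarrow> f x \<noteq> 0"
  shows "Ck_on k (\<lambda>x. inverse (f x)) S"
  using assms(2)
proof (induction k)
  case 0
  then show ?case using assms(3) by (auto intro: continuous_on_inverse)
next
  case (Suc k)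
  show ?case
  proof (rule Ck_on_SucI)
    show "((\<lambda>x. inverse (f x)) has_derivative
        (\<lambda>v. - 1 * (inverse (f x) * frechet_derivative f (at x) v * inverse (f x)))) (at x)"
      if "x \<in> S" for x
      using Deriv.has_derivative_inverse[OF assms(3)[OF that] Ck_on_SucD[OF Suc.prems that]] by simp
    show "Ck_on k (\<lambda>x. - 1 * (inverse (f x) * frechet_derivative f (at x) v * inverse (f x))) S" for v
      using Suc Ck_on_Suc_imp[OF Suc.prems] assms(1)
      by (intro Ck_on_mult Ck_on_const) auto
  qed fact
qed

text \<open>In the chain rule the direction \<open>?Dg x v\<close> varies with \<open>x\<close>,
  while \<open>Ck_on\<close> speaks of fixed directions. Expanding it in the standard basis leaves
  derivatives of \<open>f\<close> in fixed directions composed with \<open>g\<close>, to which the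
  induction hypothesis applies because only \<open>f\<close> is generalised.\<close>

lemma Ck_on_compose:
  fixes f :: "'b::euclidean_space \<Rightarrow> 'c::real_normed_vector" and g :: "'a::euclidean_space \<Rightarrow> 'b"
  assumes "open S" "open T" "Ck_on k f T" "Ck_on k g S" "g ` S \<subseteq> T"
  shows "Ck_on k (\<lambda>x. f (g x)) S"
  using assms(3,4)
proof (induction k arbitrary: f)
  case 0
  then show ?case using assms(5) by (auto intro: continuous_on_compose2)
next
  case (Suc k)
  let ?Df = "\<lambda>x. frechet_derivative f (at x)" and ?Dg = "\<lambda>x. frechet_derivative g (at x)"
  show ?case
  proof (rule Ck_on_SucI)
    fix x assume x: "x \<in> S"
    then have gx: "g x \<in> T" using assms(5) by blast
    have lin: "linear (?Df (g x))"
      using has_derivative_linear[OF Ck_on_SucD[OF Suc.prems(1) gx]] .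
    have "?Df (g x) (?Dg x v) = (\<Sum>i\<in>Basis. (?Dg x v \<bullet> i) *\<^sub>R ?Df (g x) i)" for v
      using linear_sum[OF lin] linear_scale[OF lin] euclidean_representation[of "?Dg x v"]
      by (metis (no_types, lifting) sum.cong)
    then show "((\<lambda>x. f (g x)) has_derivative
        (\<lambda>v. \<Sum>i\<in>Basis. (?Dg x v \<bullet> i) *\<^sub>R ?Df (g x) i)) (at x)"
      using has_derivative_compose[OF Ck_on_SucD[OF Suc.prems(2) x] Ck_on_SucD[OF Suc.prems(1) gx]]
      by simp
  next
    show "Ck_on k (\<lambda>x. \<Sum>i\<in>Basis. (?Dg x v \<bullet> i) *\<^sub>R ?Df (g x) i) S" for v
      using Suc.prems Ck_on_Suc_imp[OF Suc.prems(2)] assms(1)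
      by (intro Ck_on_sum Ck_on_scaleR Suc.IH Ck_on_inner Ck_on_const) auto
  qed fact
qed

lemma Ck_on_Pair:
  assumes "open S" "Ck_on k f S" "Ck_on k g S"
  shows "Ck_on k (\<lambda>x. (f x, g x)) S"
proof -
  have "Ck_on k (\<lambda>x. (f x, 0) + (0, g x)) S"
    using assms
    by (intro Ck_on_add Ck_on_linear_comp[of _ "\<lambda>y. (y, 0)"] Ck_on_linear_comp[of _ "\<lambda>y. (0, y)"])
      (auto intro: bounded_linear_Pair bounded_linear_ident bounded_linear_zero)
  then show ?thesis by simp
qed

lemma Ck_on_vec:
  fixes f :: "'a::euclidean_space \<Rightarrow> real^'n"
  assumes "open S" "\<And>i. Ck_on k (\<lambda>x. f x $ i) S"
  shows "Ck_on k f S"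
proof -
  have "f x = (\<Sum>i\<in>UNIV. f x $ i *\<^sub>R axis i 1)" for x
    by (simp add: vec_eq_iff axis_def if_distrib sum.delta' cong: if_cong)
  moreover have "Ck_on k (\<lambda>x. \<Sum>i\<in>UNIV. f x $ i *\<^sub>R axis i (1::real)) S"
    using assms by (intro Ck_on_sum Ck_on_scaleR Ck_on_const) auto
  ultimately show ?thesis by simp
qed

lemma Ck_on_vec_nth: "open S \<Longrightarrow> Ck_on k f S \<Longrightarrow> Ck_on k (\<lambda>x. f x $ i) S"
  by (rule Ck_on_linear_comp[OF _ bounded_linear_vec_nth])

lemma Ck_on_det:
  fixes J :: "'a::euclidean_space \<Rightarrow> real^'n^'n"
  assumes "open S" "\<And>i j. Ck_on k (\<lambda>x. J x $ i $ j) S"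
  shows "Ck_on k (\<lambda>x. det (J x)) S"
  unfolding det_def using assms by (intro Ck_on_sum Ck_on_mult Ck_on_const Ck_on_prod) auto

text \<open>A global inverse function theorem for injective maps. Invariance of domain gives the
  open image, a nonsingular derivative gives differentiability of the inverse, and Cramer's rule
  makes the smoothness of its derivative visible.\<close>

lemma Ck_on_inv_into:
  fixes g :: "real^'r \<Rightarrow> real^'r"
  assumes "open W" "inj_on g W" "Ck_on (Suc k) g W"
    and nonsing: "\<forall>w\<in>W. \<forall>u. frechet_derivative g (at w) u = 0 \<longrightarrow> u = 0"
  shows "open (g ` W)" "Ck_on (Suc k) (inv_into W g) (g ` W)"
proof -
  have cont: "continuous_on W g"
    using Ck_on_mono[OF assms(3), of 0] by simp
  show opn: "open (g ` W)" using invariance_of_domain[OF cont assms(1,2)] .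
  define \<psi> where "\<psi> = inv_into W g"
  have \<psi>W: "\<psi> p \<in> W" "g (\<psi> p) = p" if "p \<in> g ` W" for p
    using that by (auto simp: \<psi>_def inv_into_into f_inv_into_f)
  have \<psi>g: "\<psi> (g w) = w" if "w \<in> W" for w
    using that assms(2) by (simp add: \<psi>_def)
  define J :: "real^'r \<Rightarrow> real^'r^'r" where "J w = matrix (frechet_derivative g (at w))" for w
  have J: "frechet_derivative g (at w) u = J w *v u" if "w \<in> W" for w u
    unfolding J_def using has_derivative_linear[OF Ck_on_SucD[OF assms(3) that]]
    by simp
  have det: "det (J w) \<noteq> 0" if w: "w \<in> W" for w
  proof -
    have "\<exists>B. B ** J w = mat 1"
      using nonsing w J[OF w] by (subst matrix_left_invertible_ker) auto
    then show ?thesis by (simp add: invertible_det_nz[symmetric] invertible_left_inverse)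
  qed
  \<comment> \<open>Cramer's formula for the solution of \<open>J w *v x = u\<close>. It is a
    quotient of determinants, hence built from the entries of \<open>J w\<close> by sums, products
    and one reciprocal.\<close>
  define D :: "real^'r \<Rightarrow> real^'r \<Rightarrow> real^'r" where
    "D w u = (\<chi> l. det (\<chi> i j. if j = l then u $ i else J w $ i $ j) / det (J w))" for w u
  have JD: "J w *v D w u = u" if "w \<in> W" for w u
    using cramer[OF det[OF that], of "D w u" u] by (simp add: D_def)
  have der: "(\<psi> has_derivative D (\<psi> p)) (at p)" if p: "p \<in> g ` W" for p
  proof (rule has_derivative_inverse_strong_x[OF assms(1) _ cont])
    show "(g has_derivative frechet_derivative g (at (\<psi> p))) (at (\<psi> p))"
      by (rule Ck_on_SucD[OF assms(3) \<psi>W(1)[OF p]])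
    show "frechet_derivative g (at (\<psi> p)) \<circ> D (\<psi> p) = id"
      using J JD \<psi>W(1)[OF p] by auto
  qed (use \<psi>W[OF p] \<psi>g in auto)
  \<comment> \<open>Bootstrapping: the derivative of \<psi> at \<open>p\<close> is
    \<open>D (\<psi> p)\<close>. If \<psi> is C^j with j \<le> k, the entries of
    \<open>J (\<psi> p)\<close> are C^j, hence so is the derivative, and \<psi> gains one
    order.\<close>
  have "Ck_on j \<psi> (g ` W)" if "j \<le> Suc k" for j
    using that
  proof (induction j)
    case 0
    show ?case using der
      by (auto intro!: continuous_at_imp_continuous_on intro: has_derivative_continuous)
  next
    case (Suc j)
    then have IH: "Ck_on j \<psi> (g ` W)" and jk: "j \<le> k" by auto
    have "Ck_on j (\<lambda>w. frechet_derivative g (at w) (axis l 1) $ i) W" for i l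
      using assms(1,3) Ck_on_mono[OF _ jk] by (intro Ck_on_vec_nth) auto
    then have entry: "Ck_on j (\<lambda>p. J (\<psi> p) $ i $ l) (g ` W)" for i l
      using Ck_on_compose[OF opn assms(1) _ IH, of "\<lambda>w. J w $ i $ l"] \<psi>W(1)
      by (auto simp: J_def matrix_def)
    have "Ck_on j (\<lambda>p. D (\<psi> p) u) (g ` W)" for u
    proof (rule Ck_on_vec[OF opn])
      fix l
      have "Ck_on j (\<lambda>p. (\<chi> i j. if j = l then u $ i else J (\<psi> p) $ i $ j) $ i $ m) (g ` W)" for i m
        using entry[of i m] Ck_on_const[OF opn, of j "u $ i"] by (cases "m = l") auto
      then show "Ck_on j (\<lambda>p. D (\<psi> p) u $ l) (g ` W)"
        unfolding D_def vec_lambda_beta divide_inverse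
        using det \<psi>W(1) entry by (intro Ck_on_mult Ck_on_inverse Ck_on_det opn) auto
    qed
    then show ?case using der by (intro Ck_on_SucI[OF opn])
  qed
  then show "Ck_on (Suc k) (inv_into W g) (g ` W)" unfolding \<psi>_def by blast
qed

section \<open>Completely integrable Hamiltonians\<close>

text \<open>Each partial derivative is the derivative at 0 along a coordinate line through
  \<open>z\<close>, so the chain rule reads it off the vectors \<alpha> and \<beta> that represent
  the total derivative.\<close>

lemma partial_eq:
  assumes "(f has_derivative (\<lambda>w. \<alpha> \<bullet> fst w + \<beta> \<bullet> snd w)) (at z)"
  shows partial1_eq: "partial1 f i z = \<alpha> $ i" and partial2_eq: "partial2 f i z = \<beta> $ i"
proof -
  have der: "((\<lambda>t. f (z + t *\<^sub>R w)) has_derivative (\<lambda>t. \<alpha> \<bullet> fst (t *\<^sub>R w) + \<beta> \<bullet> snd (t *\<^sub>R w))) (at 0)"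
    for w
    by (rule has_derivative_compose[where f = "\<lambda>t. z + t *\<^sub>R w" and f' = "\<lambda>t. t *\<^sub>R w"])
      (use assms in \<open>auto intro!: derivative_eq_intros\<close>)
  have "(\<lambda>t. \<alpha> \<bullet> fst (t *\<^sub>R w) + \<beta> \<bullet> snd (t *\<^sub>R w)) = (*) (\<alpha> \<bullet> fst w + \<beta> \<bullet> snd w)" for w
    by (auto simp: fun_eq_iff algebra_simps)
  then have "deriv (\<lambda>t. f (z + t *\<^sub>R w)) 0 = \<alpha> \<bullet> fst w + \<beta> \<bullet> snd w" for w
    using der[of w] by (intro DERIV_imp_deriv) (simp add: has_field_derivative_def)
  from this[of "(axis i 1, 0)"] this[of "(0, axis i 1)"]
  show "partial1 f i z = \<alpha> $ i" "partial2 f i z = \<beta> $ i"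
    by (simp_all add: partial1_def partial2_def plus_prod_def inner_axis)
qed

lemma poisson_eq:
  assumes "(f has_derivative (\<lambda>w. \<alpha> \<bullet> fst w + \<beta> \<bullet> snd w)) (at z)"
    and "(g has_derivative (\<lambda>w. \<alpha>' \<bullet> fst w + \<beta>' \<bullet> snd w)) (at z)"
  shows "poisson f g z = \<beta> \<bullet> \<alpha>' - \<alpha> \<bullet> \<beta>'"
  by (simp add: poisson_def partial_eq[OF assms(1)] partial_eq[OF assms(2)] inner_vec_def
      sum_subtractf)

text \<open>The hyperplane orthogonal to \<kappa> has dimension r - 1, and the family enumerates a
  basis of it. Indices start at 2 because index 1 is reserved for the Hamiltonian; for r = 1 the
  family is empty.\<close>

lemma independent_family_orthogonal:
  fixes \<kappa> :: "real^'r"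
  assumes "\<kappa> \<noteq> 0"
  obtains u :: "nat \<Rightarrow> real^'r" where
    "\<And>j. j \<in> {2..CARD('r)} \<Longrightarrow> \<kappa> \<bullet> u j = 0"
    "\<And>a j. (\<Sum>j=2..CARD('r). a j *\<^sub>R u j) = 0 \<Longrightarrow> j \<in> {2..CARD('r)} \<Longrightarrow> a j = 0"
proof -
  obtain B where B: "B \<subseteq> {x. \<kappa> \<bullet> x = 0}" "independent B" "card B = dim {x. \<kappa> \<bullet> x = 0}"
    using basis_exists by metis
  have "finite B" using B(2) independent_imp_finite by blast
  moreover have "card {2..CARD('r)} = card B"
    using B(3) dim_hyperplane[OF assms] by simp
  ultimately obtain u where u: "bij_betw u {2..CARD('r)} B"
    using finite_same_card_bij[of "{2..CARD('r)}" B] by blast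
  show thesis
  proof
    show "\<kappa> \<bullet> u j = 0" if "j \<in> {2..CARD('r)}" for j
      using bij_betwE[OF u] that B(1) by blast
    show "a j = 0" if "(\<Sum>j=2..CARD('r). a j *\<^sub>R u j) = 0" "j \<in> {2..CARD('r)}" for a j
    proof -
      let ?v = "inv_into {2..CARD('r)} u"
      have "(\<Sum>x\<in>B. a (?v x) *\<^sub>R x) = (\<Sum>j=2..CARD('r). a j *\<^sub>R u j)"
        using sum.reindex_bij_betw[OF u, of "\<lambda>x. a (?v x) *\<^sub>R x"] u
        by (simp add: bij_betw_def)
      then have "(\<Sum>x\<in>B. a (?v x) *\<^sub>R x) = 0" using that(1) by simp
      then have "a (?v (u j)) = 0"
        by (rule independentD[OF B(2) \<open>finite B\<close> subset_refl]) (use bij_betwE[OF u] that(2) in blast)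
      then show ?thesis using that(2) u by (simp add: bij_betw_def)
    qed
  qed
qed

text \<open>Only the Hamiltonian depends on \<open>q\<close>, and its \<open>q\<close>-gradient is
  the constant - \<kappa>. Brackets among the linear integrals therefore vanish, and those with the
  Hamiltonian reduce to multiples of \<kappa> \<bullet> \<open>u j\<close> = 0.\<close>

lemma completely_integrable_separable:
  fixes H :: "'r::finite phase \<Rightarrow> real"
  assumes U: "open U" "Ck_on (Suc k) R U" and "\<kappa> \<noteq> 0"
    and H: "\<forall>q. \<forall>p\<in>U. H (q, p) = R p - \<kappa> \<bullet> q"
  shows "completely_integrable (Suc k) (UNIV \<times> U) H"
proof -
  let ?N = "UNIV \<times> U :: 'r phase set"
  let ?I = "{1..CARD('r)}"
  have split: "?I = insert 1 {2..CARD('r)}" "1 \<notin> {2..CARD('r)}"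
    using zero_less_card_finite[where 'a = 'r] by auto
  have opn: "open ?N" using U(1) by (simp add: open_Times)
  obtain u :: "nat \<Rightarrow> real^'r" where u: "\<And>j. j \<in> {2..CARD('r)} \<Longrightarrow> \<kappa> \<bullet> u j = 0"
    "\<And>a j. (\<Sum>j=2..CARD('r). a j *\<^sub>R u j) = 0 \<Longrightarrow> j \<in> {2..CARD('r)} \<Longrightarrow> a j = 0"
    using independent_family_orthogonal[OF \<open>\<kappa> \<noteq> 0\<close>] by blast
  \<comment> \<open>\<open>f 1\<close> is written through \<open>R\<close> and only agrees with
    \<open>H\<close> on the phase space, where alone \<open>H\<close> is known.\<close>
  define f :: "nat \<Rightarrow> 'r phase \<Rightarrow> real" where
    "f j = (if j = 1 then (\<lambda>z. R (snd z) - \<kappa> \<bullet> fst z) else (\<lambda>z. u j \<bullet> snd z))" for j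
  \<comment> \<open>\<alpha> and \<beta> are the gradients of \<open>f j\<close> in \<open>q\<close>
    and in \<open>p\<close>. The adjoint of a linear functional, applied to 1, is the vector
    representing that functional.\<close>
  define \<alpha> where "\<alpha> j = (if j = 1 then - \<kappa> else 0)" for j :: nat
  define \<beta> where
    "\<beta> j p = (if j = 1 then adjoint (frechet_derivative R (at p)) 1 else u j)" for j p
  have der: "(f j has_derivative (\<lambda>w. \<alpha> j \<bullet> fst w + \<beta> j (snd z) \<bullet> snd w)) (at z)"
    if "z \<in> ?N" for j z
  proof (cases "j = 1")
    case True
    let ?D = "frechet_derivative R (at (snd z))"
    have D: "(R has_derivative ?D) (at (snd z))"
      using Ck_on_SucD[OF U(2)] that by (cases z) auto
    have "((\<lambda>z. R (snd z)) has_derivative (\<lambda>w. ?D (snd w))) (at z)"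
      using has_derivative_compose[OF has_derivative_snd[OF has_derivative_ident] D] by simp
    then have "((\<lambda>z. R (snd z) - \<kappa> \<bullet> fst z) has_derivative (\<lambda>w. ?D (snd w) - \<kappa> \<bullet> fst w)) (at z)"
      by (auto intro!: derivative_eq_intros)
    moreover have "?D d = \<beta> j (snd z) \<bullet> d" for d
      using adjoint_works[OF has_derivative_linear[OF D], of d 1] True
      by (simp add: \<beta>_def inner_commute)
    ultimately show ?thesis using True by (simp add: f_def \<alpha>_def)
  next
    case False
    then show ?thesis by (auto simp: f_def \<alpha>_def \<beta>_def intro!: derivative_eq_intros)
  qed
  have comm: "\<beta> i p \<bullet> \<alpha> j = \<alpha> i \<bullet> \<beta> j p" if "i \<in> ?I" "j \<in> ?I" for i j p
    using that u(1)[of i] u(1)[of j] by (auto simp: \<alpha>_def \<beta>_def inner_commute)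
  have "Ck_on (Suc k) (f j) ?N" for j
  proof (cases "j = 1")
    case True
    have "Ck_on (Suc k) (\<lambda>z. R (snd z)) ?N"
      by (rule Ck_on_compose[OF opn U Ck_on_linear[OF opn bounded_linear_snd]]) auto
    moreover have "Ck_on (Suc k) (\<lambda>z. (- \<kappa>) \<bullet> fst z) ?N"
      by (intro Ck_on_linear opn bounded_linear_compose[OF bounded_linear_inner_right bounded_linear_fst])
    ultimately have "Ck_on (Suc k) (\<lambda>z. R (snd z) + (- \<kappa>) \<bullet> fst z) ?N" by (rule Ck_on_add[OF opn])
    moreover have "f j = (\<lambda>z. R (snd z) + (- \<kappa>) \<bullet> fst z)" using True by (simp add: f_def)
    ultimately show ?thesis by (simp only:)
  next
    case False
    then have "f j = (\<lambda>z. u j \<bullet> snd z)" by (simp add: f_def)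
    then show ?thesis
      by (simp only:) (intro Ck_on_linear opn
        bounded_linear_compose[OF bounded_linear_inner_right bounded_linear_snd])
  qed
  moreover have "poisson (f i) (f j) z = 0" if "i \<in> ?I" "j \<in> ?I" "z \<in> ?N" for i j z
    using poisson_eq[OF der der, OF that(3,3)] comm[OF that(1,2)] by simp
  moreover have "\<forall>i\<in>?I. a i = 0"
    if z: "z \<in> ?N" and a: "\<forall>w. (\<Sum>i\<in>?I. a i * frechet_derivative (f i) (at z) w) = 0" for z a
  proof -
    have *: "a 1 * (\<alpha> 1 \<bullet> fst w + \<beta> 1 (snd z) \<bullet> snd w) + (\<Sum>i=2..CARD('r). a i * (u i \<bullet> snd w)) = 0" for w
    proof -
      have "(\<Sum>i\<in>?I. a i * (\<alpha> i \<bullet> fst w + \<beta> i (snd z) \<bullet> snd w)) = 0"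
        using a by (simp add: frechet_derivative_eq[OF der[OF z]])
      then show ?thesis unfolding split(1)
        by (subst (asm) sum.insert) (auto simp: \<alpha>_def \<beta>_def)
    qed
    \<comment> \<open>The direction (\<kappa>, 0) is annihilated by all differentials except the
      first, which takes the value - \<kappa> \<bullet> \<kappa> there.\<close>
    have a1: "a 1 = 0" using *[of "(\<kappa>, 0)"] \<open>\<kappa> \<noteq> 0\<close> by (simp add: \<alpha>_def)
    \<comment> \<open>With \<open>a 1 = 0\<close>, testing against (0, \<open>?s\<close>) turns the
      relation into \<open>?s\<close> \<bullet> \<open>?s\<close> = 0, and independence of the
      \<open>u i\<close> finishes.\<close>
    let ?s = "\<Sum>i=2..CARD('r). a i *\<^sub>R u i"
    have "?s \<bullet> ?s = 0" using *[of "(0, ?s)"] a1 by (simp add: inner_sum_left)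
    then have "?s = 0" by simp
    then have "a i = 0" if "i \<in> {2..CARD('r)}" for i using u(2) that by blast
    then show ?thesis unfolding split(1) using a1 by blast
  qed
  ultimately show ?thesis
    unfolding completely_integrable_def
    using H by (intro exI[of _ f]) (simp add: f_def del: Ck_on.simps)
qed

section \<open>The Legendre transform in orthonormal coordinates\<close>

text \<open>The inverse of a map that fixes \<open>q\<close> and applies \<open>g\<close> to the
  fibre has the same shape with the inverse of \<open>g\<close>. Both directions thus reduce to one
  smoothness fact about such maps, transferred along equality on the open sets concerned.\<close>

lemma fibrewise_diffeo:
  fixes g :: "real^'r \<Rightarrow> real^'r" and \<Phi> :: "'r phase \<Rightarrow> 'r phase"
  assumes g: "open W" "inj_on g W" "Ck_on (Suc k) g W"
      "\<forall>w\<in>W. \<forall>u. frechet_derivative g (at w) u = 0 \<longrightarrow> u = 0"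
    and \<Phi>: "\<forall>q. \<forall>v\<in>W. \<Phi> (q, v) = (q, g v)"
  shows "diffeo (Suc k) \<Phi> (UNIV \<times> W) (UNIV \<times> g ` W)"
    and "p \<in> g ` W \<Longrightarrow> inv_into (UNIV \<times> W) \<Phi> (q, p) = (q, inv_into W g p)"
proof -
  let ?M = "UNIV \<times> W :: 'r phase set" and ?N = "UNIV \<times> g ` W :: 'r phase set"
  have opn: "open ?M" "open ?N" using g(1) Ck_on_inv_into(1)[OF g] by (simp_all add: open_Times)
  have inj: "inj_on \<Phi> ?M" using g(2) \<Phi> by (auto simp: inj_on_def)
  have img: "\<Phi> ` ?M = ?N" using \<Phi> by (force simp: image_iff)
  show inv: "inv_into ?M \<Phi> (q, p) = (q, inv_into W g p)" if "p \<in> g ` W" for q p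
    using that \<Phi> by (intro inv_into_f_eq[OF inj]) (auto simp: inv_into_into f_inv_into_f)
  have fibre: "Ck_on (Suc k) (\<lambda>z. (fst z, f (snd z))) (UNIV \<times> V :: 'r phase set)"
    if "open V" "Ck_on (Suc k) f V" for f :: "real^'r \<Rightarrow> real^'r" and V
  proof -
    have o: "open (UNIV \<times> V :: 'r phase set)" using that(1) by (simp add: open_Times)
    have "Ck_on (Suc k) (\<lambda>z. f (snd z)) (UNIV \<times> V :: 'r phase set)"
      by (rule Ck_on_compose[OF o that Ck_on_linear[OF o bounded_linear_snd]]) auto
    then show ?thesis by (rule Ck_on_Pair[OF o Ck_on_linear[OF o bounded_linear_fst]])
  qed
  have "Ck_on (Suc k) \<Phi> ?M"
    by (rule Ck_on_cong[OF opn(1) fibre[OF g(1,3)]]) (auto simp: \<Phi>)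
  moreover have "Ck_on (Suc k) (inv_into ?M \<Phi>) ?N"
    by (rule Ck_on_cong[OF opn(2) fibre[OF Ck_on_inv_into[OF g]]]) (auto simp: inv)
  ultimately show "diffeo (Suc k) \<Phi> ?M ?N"
    using opn inj img by (simp add: diffeo_def bij_betw_def)
qed

text \<open>Abstracts \<open>h\<close> along the constraint, read in coordinates: \<open>g\<close>
  is the gradient of \<open>G\<close>, and the last assumption is positive definiteness of the
  Hessian of \<open>G\<close>.\<close>

locale convex_gradient =
  fixes W :: "(real^'r::finite) set" and G :: "real^'r \<Rightarrow> real" and g :: "real^'r \<Rightarrow> real^'r"
  assumes open_W: "open W" and convex_W: "convex W"
    and G_deriv: "v \<in> W \<Longrightarrow> (G has_derivative (\<lambda>d. g v \<bullet> d)) (at v)"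
    and g_C1: "Ck_on 1 g W"
    and g_pos: "v \<in> W \<Longrightarrow> u \<noteq> 0 \<Longrightarrow> 0 < u \<bullet> frechet_derivative g (at v) u"
begin

lemma g_deriv: "v \<in> W \<Longrightarrow> (g has_derivative frechet_derivative g (at v)) (at v)"
  using Ck_on_SucD[of 0 g] g_C1 by simp

lemma g_nonsingular: "\<forall>v\<in>W. \<forall>u. frechet_derivative g (at v) u = 0 \<longrightarrow> u = 0"
  using g_pos by (metis inner_zero_right less_irrefl)

text \<open>Strict monotonicity of the gradient: along the segment from \<open>v\<close> to
  \<open>w\<close>, the function (w - v) \<bullet> g has a positive derivative, so its end values
  differ.\<close>

lemma g_inj: "inj_on g W"
proof (rule inj_onI, rule ccontr)
  fix v w assume vw: "v \<in> W" "w \<in> W" "g v = g w" "v \<noteq> w"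
  define l where "l t = v + t *\<^sub>R (w - v)" for t
  have l: "l t \<in> W" if "0 \<le> t" "t \<le> 1" for t
    using convexD_alt[OF convex_W vw(1,2) that] by (simp add: l_def algebra_simps)
  have "(w - v) \<bullet> g (l 0) < (w - v) \<bullet> g (l 1)"
  proof (rule DERIV_pos_imp_increasing[where f = "\<lambda>t. (w - v) \<bullet> g (l t)"])
    fix t :: real assume t: "0 \<le> t" "t \<le> 1"
    let ?D = "frechet_derivative g (at (l t))"
    have "(l has_derivative (\<lambda>s. s *\<^sub>R (w - v))) (at t)"
      unfolding l_def by (auto intro!: derivative_eq_intros)
    from has_derivative_compose[OF this g_deriv[OF l[OF t]]]
    have "((\<lambda>t. (w - v) \<bullet> g (l t)) has_derivative (\<lambda>s. (w - v) \<bullet> ?D (s *\<^sub>R (w - v)))) (at t)"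
      by (auto intro!: derivative_eq_intros)
    then have "((\<lambda>t. (w - v) \<bullet> g (l t)) has_real_derivative (w - v) \<bullet> ?D (w - v)) (at t)"
      using linear_scale[OF has_derivative_linear[OF g_deriv[OF l[OF t]]]]
      by (simp add: has_field_derivative_def mult_commute_abs)
    then show "\<exists>y. ((\<lambda>t. (w - v) \<bullet> g (l t)) has_real_derivative y) (at t) \<and> 0 < y"
      using g_pos[OF l[OF t], of "w - v"] vw(4) by auto
  qed simp
  then show False using vw(3) by (simp add: l_def)
qed

lemma G_Ck: "Ck_on k g W \<Longrightarrow> Ck_on (Suc k) G W"
  by (rule Ck_on_SucI[OF open_W G_deriv]) (auto intro!: Ck_on_inner[OF open_W _ Ck_on_const[OF open_W]])

lemma uminus_g_Ck: "Ck_on k g W \<Longrightarrow> Ck_on k (\<lambda>v. - g v) W"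
  by (rule Ck_on_linear_comp[OF open_W bounded_linear_minus[OF bounded_linear_ident]])

lemma uminus_g:
  shows "inj_on (\<lambda>v. - g v) W"
    and "\<forall>w\<in>W. \<forall>u. frechet_derivative (\<lambda>v. - g v) (at w) u = 0 \<longrightarrow> u = 0"
  using g_inj g_nonsingular
  by (auto simp: inj_on_def frechet_derivative_eq[OF has_derivative_minus[OF g_deriv]])

text \<open>The part of the Hamiltonian that depends on momenta only, with \<psi> recovering the
  velocity. If \<psi> inverts - g, this is minus the convex conjugate of \<open>G\<close> over
  \<open>W\<close>, taken at - p. If \<psi> inverts \<open>g\<close>, the sign of \<open>G\<close>
  is opposite to that in a conjugate.\<close>

definition dual_part :: "(real^'r \<Rightarrow> real^'r) \<Rightarrow> real^'r \<Rightarrow> real" where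
  "dual_part \<psi> p = p \<bullet> \<psi> p + G (\<psi> p)"

text \<open>Serves the convention without the minus sign, where the order of the result is that of
  \<psi>.\<close>

lemma dual_part_Ck:
  assumes "open U" "Ck_on k g W" "Ck_on k \<psi> U" "\<psi> ` U \<subseteq> W"
  shows "Ck_on k (dual_part \<psi>) U"
  unfolding dual_part_def
  by (intro Ck_on_add Ck_on_inner Ck_on_linear bounded_linear_ident assms
      Ck_on_compose[OF assms(1) open_W _ assms(3,4)] Ck_on_Suc_imp[OF G_Ck])

text \<open>The derivative of the conjugate of a function does not involve the derivative of the
  inverse gradient, which gains one order of differentiability.\<close>

lemma dual_part_uminus:
  defines "\<xi> \<equiv> inv_into W (\<lambda>v. - g v)" and "U \<equiv> (\<lambda>v. - g v) ` W"
  shows "p \<in> U \<Longrightarrow> (dual_part \<xi> has_derivative (\<lambda>d. \<xi> p \<bullet> d)) (at p)"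
    and "Ck_on 2 (dual_part \<xi>) U"
proof -
  have "Ck_on (Suc 0) (\<lambda>v. - g v) W" using uminus_g_Ck[OF g_C1] by simp
  note inv = Ck_on_inv_into[OF open_W uminus_g(1) this uminus_g(2), folded \<xi>_def U_def]
  have C1: "Ck_on (Suc 0) \<xi> U" and opn: "open U" by (rule inv)+
  show der: "(dual_part \<xi> has_derivative (\<lambda>d. \<xi> p \<bullet> d)) (at p)" if p: "p \<in> U" for p
  proof -
    let ?D = "frechet_derivative \<xi> (at p)"
    have \<xi>p: "\<xi> p \<in> W" "- g (\<xi> p) = p"
      using p by (auto simp: \<xi>_def U_def inv_into_into f_inv_into_f[of p "\<lambda>v. - g v"])
    have D: "(\<xi> has_derivative ?D) (at p)" using Ck_on_SucD[OF C1 p] .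
    have "(dual_part \<xi> has_derivative (\<lambda>d. (p \<bullet> ?D d + d \<bullet> \<xi> p) + g (\<xi> p) \<bullet> ?D d)) (at p)"
      unfolding dual_part_def
      by (intro has_derivative_add has_derivative_inner has_derivative_ident D
          has_derivative_compose[OF D G_deriv[OF \<xi>p(1)]])
    \<comment> \<open>As p = - g (\<xi> p), the two terms containing the derivative of \<xi> cancel.
      For the inverse of \<open>g\<close> they would add up instead.\<close>
    moreover have "p \<bullet> ?D d + g (\<xi> p) \<bullet> ?D d = 0" for d
      using \<xi>p(2) by (metis add.left_inverse inner_left_distrib inner_zero_left)
    then have "(\<lambda>d. (p \<bullet> ?D d + d \<bullet> \<xi> p) + g (\<xi> p) \<bullet> ?D d) = (\<lambda>d. \<xi> p \<bullet> d)"
      by (auto simp: inner_commute algebra_simps)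
    ultimately show ?thesis by simp
  qed
  show "Ck_on 2 (dual_part \<xi>) U"
    unfolding numeral_2_eq_2
    by (rule Ck_on_SucI[OF opn der]) (assumption, rule Ck_on_inner[OF opn C1 Ck_on_const[OF opn]])
qed

section \<open>The Lagrangian in coordinates under the two sign conventions\<close>

context
  fixes \<kappa> :: "real^'r" and L :: "'r phase \<Rightarrow> real"
  assumes \<kappa>: "\<kappa> \<noteq> 0" and L: "L = (\<lambda>(q, v). \<kappa> \<bullet> q - G v)"
begin

lemma L_deriv:
  assumes "v \<in> W"
  shows "(L has_derivative (\<lambda>w. \<kappa> \<bullet> fst w + (- g v) \<bullet> snd w)) (at (q, v))"
proof -
  have "((\<lambda>z. G (snd z)) has_derivative (\<lambda>w. g v \<bullet> snd w)) (at (q, v))"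
    using has_derivative_compose[OF has_derivative_snd[OF has_derivative_ident], of G _ "(q, v)"]
      G_deriv[OF assms] by simp
  then show ?thesis by (auto simp: L case_prod_unfold intro!: derivative_eq_intros)
qed

lemma legendre_transform_L: "\<forall>q. \<forall>v\<in>W. legendre_transform L (q, v) = (q, - g v)"
  by (simp add: legendre_transform_def partial2_eq[OF L_deriv] vec_eq_iff)

text \<open>The convention without the minus sign, where \<Phi> is fibrewise \<open>g\<close>. The
  order obtained is that of \<open>g\<close>: one in general, two if \<Phi> is assumed to be
  C^2.\<close>

lemma hamiltonian_side:
  assumes \<Phi>: "\<Phi> = (\<lambda>(q, v). (q, g v))"
    and H: "\<And>q p. p \<in> g ` W \<Longrightarrow> H (q, p) = p \<bullet> inv_into W g p - L (q, inv_into W g p)"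
  shows "diffeo 1 \<Phi> (UNIV \<times> W) (UNIV \<times> g ` W)"
    and "\<forall>z\<in>UNIV \<times> g ` W. H z = hamiltonian_via \<Phi> (UNIV \<times> W) L z"
    and "completely_integrable 1 (UNIV \<times> g ` W) H"
    and "Ck_on 2 \<Phi> (UNIV \<times> W) \<Longrightarrow>
      diffeo 2 \<Phi> (UNIV \<times> W) (UNIV \<times> g ` W) \<and> completely_integrable 2 (UNIV \<times> g ` W) H"
proof -
  have \<Phi>': "\<forall>q. \<forall>v\<in>W. \<Phi> (q, v) = (q, g v)" by (simp add: \<Phi>)
  note fd = fibrewise_diffeo[OF open_W g_inj _ g_nonsingular \<Phi>']
  have gC1: "Ck_on (Suc 0) g W" using g_C1 by simp
  show "\<forall>z\<in>UNIV \<times> g ` W. H z = hamiltonian_via \<Phi> (UNIV \<times> W) L z"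
    using fd(2)[OF gC1] H by (auto simp: hamiltonian_via_def)
  have main: "diffeo (Suc k) \<Phi> (UNIV \<times> W) (UNIV \<times> g ` W) \<and>
      completely_integrable (Suc k) (UNIV \<times> g ` W) H" if gC: "Ck_on (Suc k) g W" for k
  proof
    show "diffeo (Suc k) \<Phi> (UNIV \<times> W) (UNIV \<times> g ` W)" by (rule fd(1)[OF gC])
    note inv = Ck_on_inv_into[OF open_W g_inj gC g_nonsingular]
    show "completely_integrable (Suc k) (UNIV \<times> g ` W) H"
    proof (rule completely_integrable_separable[OF inv(1) _ \<kappa>])
      show "Ck_on (Suc k) (dual_part (inv_into W g)) (g ` W)"
        by (rule dual_part_Ck[OF inv(1) gC inv(2)]) (auto intro: inv_into_into)
      show "\<forall>q. \<forall>p\<in>g ` W. H (q, p) = dual_part (inv_into W g) p - \<kappa> \<bullet> q"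
        using H by (simp add: L dual_part_def)
    qed
  qed
  show "diffeo 1 \<Phi> (UNIV \<times> W) (UNIV \<times> g ` W)" "completely_integrable 1 (UNIV \<times> g ` W) H"
    using main[OF gC1] by simp_all
  show "diffeo 2 \<Phi> (UNIV \<times> W) (UNIV \<times> g ` W) \<and> completely_integrable 2 (UNIV \<times> g ` W) H"
    if C2: "Ck_on 2 \<Phi> (UNIV \<times> W)"
  proof -
    \<comment> \<open>The slice q = 0 followed by the second projection recovers \<open>g\<close>
      from \<Phi>, so \<open>g\<close> inherits the order of \<Phi>.\<close>
    have "Ck_on 2 (\<lambda>v. \<Phi> (0, v)) W"
      by (rule Ck_on_compose[OF open_W _ C2])
        (auto intro!: Ck_on_linear bounded_linear_Pair bounded_linear_zero bounded_linear_ident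
          open_Times open_W)
    from Ck_on_linear_comp[OF open_W bounded_linear_snd this]
    have "Ck_on (Suc 1) g W" by (simp add: \<Phi> numeral_2_eq_2 del: Ck_on.simps)
    then show ?thesis using main[of 1] by (simp add: numeral_2_eq_2)
  qed
qed

text \<open>The Legendre transform taken by its definition. Although \<Phi>' is obtained only as a
  C^1 diffeomorphism, the Hamiltonian is C^2, because its momentum part has the C^1 map \<xi> as
  gradient. That same gradient makes the two systems of equations agree term by term.\<close>

lemma lagrangian_side:
  defines "M \<equiv> UNIV \<times> W" and "N' \<equiv> UNIV \<times> (\<lambda>v. - g v) ` W"
    and "\<xi> \<equiv> inv_into W (\<lambda>v. - g v)" and "\<Phi>' \<equiv> legendre_transform L"
  defines "H' \<equiv> hamiltonian_via \<Phi>' M L"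
  shows "diffeo 1 \<Phi>' M N'"
    and "\<And>q p. p \<in> (\<lambda>v. - g v) ` W \<Longrightarrow> H' (q, p) = p \<bullet> \<xi> p - L (q, \<xi> p)"
    and "open T \<Longrightarrow> \<gamma> ` T \<subseteq> M \<Longrightarrow>
      lagrangian_trajectory L T \<gamma> \<longleftrightarrow> hamiltonian_trajectory H' T (\<Phi>' \<circ> \<gamma>)"
    and "completely_integrable 2 N' H'"
proof -
  let ?U = "(\<lambda>v. - g v) ` W"
  have gC1: "Ck_on (Suc 0) (\<lambda>v. - g v) W" using uminus_g_Ck[OF g_C1] by simp
  note fd = fibrewise_diffeo[OF open_W uminus_g(1) gC1 uminus_g(2) legendre_transform_L,
      folded \<Phi>'_def M_def \<xi>_def N'_def]
  show "diffeo 1 \<Phi>' M N'" using fd(1) by simp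
  show H': "H' (q, p) = p \<bullet> \<xi> p - L (q, \<xi> p)" if "p \<in> ?U" for q p
    using fd(2)[OF that] by (simp add: H'_def hamiltonian_via_def)
  have opn: "open ?U" by (rule Ck_on_inv_into(1)[OF open_W uminus_g(1) gC1 uminus_g(2)])
  have H'_sep: "\<forall>q. \<forall>p\<in>?U. H' (q, p) = dual_part \<xi> p - \<kappa> \<bullet> q"
    using H' by (simp add: L dual_part_def)
  have C2: "Ck_on (Suc 1) (dual_part \<xi>) ?U"
    using dual_part_uminus(2) by (simp add: \<xi>_def numeral_2_eq_2 del: Ck_on.simps)
  have "completely_integrable (Suc 1) (UNIV \<times> ?U) H'"
    by (rule completely_integrable_separable[OF opn C2 \<kappa> H'_sep])
  then show "completely_integrable 2 N' H'" by (simp add: N'_def numeral_2_eq_2)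
  \<comment> \<open>At the image of (q, v) the momentum gradient of the Hamiltonian is the velocity
    \<open>v\<close>, and the position gradient is the negative of that of \<open>L\<close>.\<close>
  have H'_deriv: "(H' has_derivative (\<lambda>w. (- \<kappa>) \<bullet> fst w + v \<bullet> snd w)) (at (q, - g v))"
    if v: "v \<in> W" for q v
  proof -
    have \<xi>v: "\<xi> (- g v) = v"
      using inv_into_f_f[OF uminus_g(1) v] by (simp add: \<xi>_def)
    have d: "(dual_part \<xi> has_derivative (\<lambda>d. v \<bullet> d)) (at (- g v))"
      using dual_part_uminus(1)[of "- g v"] v \<xi>v by (auto simp: \<xi>_def)
    have "((\<lambda>z. dual_part \<xi> (snd z)) has_derivative (\<lambda>w. v \<bullet> snd w)) (at (q, - g v))"
      using has_derivative_compose[OF has_derivative_snd[OF has_derivative_ident], of "dual_part \<xi>" _ "(q, - g v)"]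
        d by simp
    then have "((\<lambda>z. dual_part \<xi> (snd z) - \<kappa> \<bullet> fst z) has_derivative
        (\<lambda>w. (- \<kappa>) \<bullet> fst w + v \<bullet> snd w)) (at (q, - g v))"
      by (auto intro!: derivative_eq_intros)
    \<comment> \<open>The separated formula holds for \<open>H'\<close> on \<open>N'\<close> only,
      so the derivative is carried over using that this set is open.\<close>
    then show ?thesis
      by (rule has_derivative_transform_within_open[of _ _ _ _ N'])
        (use v opn in \<open>auto simp: N'_def H'_sep open_Times\<close>)
  qed
  show "lagrangian_trajectory L T \<gamma> \<longleftrightarrow> hamiltonian_trajectory H' T (\<Phi>' \<circ> \<gamma>)"
    if T: "open T" "\<gamma> ` T \<subseteq> M"
  proof -
    have "partial1 L i (\<gamma> t) = - partial1 H' i (\<Phi>' (\<gamma> t)) \<and> snd (\<gamma> t) $ i = partial2 H' i (\<Phi>' (\<gamma> t))"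
      if "t \<in> T" for t i
    proof -
      obtain q v where qv: "\<gamma> t = (q, v)" "v \<in> W" using T(2) \<open>t \<in> T\<close> by (auto simp: M_def)
      then show ?thesis
        using partial_eq[OF H'_deriv[OF qv(2)]] partial_eq[OF L_deriv[OF qv(2)]]
          legendre_transform_L by (simp add: \<Phi>'_def)
    qed
    \<comment> \<open>These are equalities for all \<open>s\<close>: the functions differentiated in
      the two definitions of a trajectory are the same.\<close>
    moreover have "snd ((\<Phi>' \<circ> \<gamma>) s) $ i = partial2 L i (\<gamma> s)" "fst ((\<Phi>' \<circ> \<gamma>) s) = fst (\<gamma> s)" for s i
      by (simp_all add: \<Phi>'_def legendre_transform_def case_prod_unfold)
    ultimately show ?thesis
      by (simp add: lagrangian_trajectory_def hamiltonian_trajectory_def)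
  qed
qed

end

end

section \<open>Orthonormal coordinates and gradients\<close>

text \<open>\<open>F\<close> is adjoint and left inverse to \<open>E\<close>, so \<open>E\<close>
  composed with \<open>F\<close> is the orthogonal projection onto the range of \<open>E\<close>,
  and \<open>F a = 0\<close> says that the offset is orthogonal to it. The residual is killed by
  \<open>F\<close>, hence orthogonal to the range, and Pythagoras gives minimality.\<close>

lemma closest_point_affine:
  fixes E :: "'a::euclidean_space \<Rightarrow> 'b::euclidean_space"
  assumes "linear E" "linear F" and adj: "\<And>v y. E v \<bullet> y = v \<bullet> F y" and "\<And>v. F (E v) = v"
    and "F a = 0"
  shows "closest_point (range (\<lambda>v. a + E v)) y = a + E (F y)"
proof (rule closest_point_unique[symmetric])
  have rng: "range (\<lambda>v. a + E v) = (+) a ` range E" by auto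
  have sub: "subspace (range E)" using linear_subspace_image[OF assms(1)] by simp
  show "convex (range (\<lambda>v. a + E v))" "closed (range (\<lambda>v. a + E v))"
    unfolding rng using sub by (auto intro: convex_translation subspace_imp_convex
        closed_translation closed_subspace)
  show "\<forall>z\<in>range (\<lambda>v. a + E v). dist y (a + E (F y)) \<le> dist y z"
  proof clarsimp
    fix v
    let ?d = "y - (a + E (F y))"
    have "F ?d = 0"
      using assms by (simp add: linear_diff linear_add)
    then have "E (F y - v) \<bullet> ?d = 0" by (simp add: adj)
    then have "(norm (?d + E (F y - v)))\<^sup>2 = (norm ?d)\<^sup>2 + (norm (E (F y - v)))\<^sup>2"
      by (intro norm_add_Pythagorean) (simp add: orthogonal_def inner_commute)
    moreover have "?d + E (F y - v) = y - (a + E v)"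
      using assms(1) by (simp add: linear_diff)
    ultimately have "(norm ?d)\<^sup>2 \<le> (norm (y - (a + E v)))\<^sup>2" by simp
    then show "dist y (a + E (F y)) \<le> dist y (a + E v)"
      using power2_le_imp_le by (fastforce simp: dist_norm)
  qed
qed simp

text \<open>Riesz representation in the standard basis supplies existence and uniqueness for the
  definite description in \<open>gradient\<close>.\<close>

lemma gradient_deriv:
  assumes "(f has_derivative f') (at x)"
  shows "gradient f x = (\<Sum>b\<in>Basis. f' b *\<^sub>R b)"
    and "(f has_derivative (\<lambda>d. gradient f x \<bullet> d)) (at x)"
proof -
  let ?D = "\<Sum>b\<in>Basis. f' b *\<^sub>R b"
  have lin: "linear f'" using has_derivative_linear[OF assms] .
  have f': "f' d = d \<bullet> ?D" for d
  proof -
    have "f' d = f' (\<Sum>b\<in>Basis. (d \<bullet> b) *\<^sub>R b)" by (simp add: euclidean_representation)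
    also have "\<dots> = d \<bullet> ?D"
      using lin by (simp add: linear_sum linear_scale inner_sum_right mult.commute)
    finally show ?thesis .
  qed
  have "f' = (\<lambda>d. d \<bullet> ?D)" using f' by blast
  then have D: "GDERIV f x :> ?D" using assms by (simp add: gderiv_def)
  show grad: "gradient f x = ?D" unfolding gradient_def
  proof (rule the_equality)
    show "GDERIV f x :> ?D" by (rule D)
  next
    fix D' assume "GDERIV f x :> D'"
    then have "(\<lambda>d. d \<bullet> D') = f'"
      using has_derivative_unique assms by (auto simp: gderiv_def)
    then show "D' = ?D" using f' by (metis vector_eq_rdot inner_commute)
  qed
  show "(f has_derivative (\<lambda>d. gradient f x \<bullet> d)) (at x)"
    using D grad by (simp add: gderiv_def inner_commute)
qed

lemma Ck_on_gradient:
  assumes "open S" "Ck_on (Suc k) f S"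
  shows "Ck_on k (gradient f) S"
proof (rule Ck_on_cong[OF assms(1)])
  show "Ck_on k (\<lambda>x. \<Sum>b\<in>Basis. frechet_derivative f (at x) b *\<^sub>R b) S"
    using assms by (intro Ck_on_sum Ck_on_scaleR Ck_on_const) auto
qed (use gradient_deriv(1)[OF Ck_on_SucD[OF assms(2)]] in simp)

lemma orthonormal_coords:
  fixes e :: "'r::finite \<Rightarrow> real^'n"
  assumes "orthonormal_basis_of e S"
    and E_def: "E = (\<lambda>v. \<Sum>i\<in>UNIV. v $ i *\<^sub>R e i)" and F_def: "F = (\<lambda>x. \<chi> i. x \<bullet> e i)"
  shows "linear E" "linear F" "E v \<bullet> y = v \<bullet> F y" "F (E v) = v" "range E = S"
proof -
  show lin: "linear E" "linear F"
    by (auto simp: E_def F_def linear_iff scaleR_left_distrib sum.distrib scaleR_sum_right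
        vec_eq_iff inner_left_distrib)
  show adj: "E v \<bullet> y = v \<bullet> F y" for v y
    by (simp add: E_def F_def inner_sum_left inner_vec_def[of v] inner_commute[of y])
  have orth: "e i \<bullet> e j = (if i = j then 1 else 0)" for i j
    using assms(1) by (simp add: orthonormal_basis_of_def)
  show "F (E v) = v"
    by (simp add: F_def E_def vec_eq_iff inner_sum_left orth if_distrib sum.delta cong: if_cong)
  have "subspace (range E)" using linear_subspace_image[OF lin(1)] by simp
  moreover have "e i \<in> range E" for i
  proof
    show "e i = E (axis i 1)"
      by (simp add: E_def axis_def if_distrib[of "\<lambda>c. c *\<^sub>R _"] sum.delta' cong: if_cong)
  qed simp
  ultimately have "span (range e) \<subseteq> range E" by (intro span_minimal) auto
  moreover have "range E \<subseteq> span (range e)"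
    unfolding E_def by (auto intro!: span_sum span_scale intro: span_base)
  ultimately show "range E = S" using assms(1) by (simp add: orthonormal_basis_of_def)
qed

section \<open>Transfer of the theorem to coordinates\<close>

theorem theorem5p4:
  fixes A :: "real^'n^'m" and b :: "real^'m" and C :: "(real^'n) set"
    and h :: "real^'n \<Rightarrow> ereal" and c :: "real^'n" and e :: "'r::finite \<Rightarrow> real^'n"
  assumes "CARD('m) < CARD('n)" and "rank A = CARD('m)" and "b \<in> range ((*v) A)"
    and "C \<noteq> {}" and "open C" and "convex C" and "feas A b C \<noteq> {}"
    and "admissible_barrier C h"
    and "orthonormal_basis_of e (ker_of A)"
    and "proj_ker A c \<noteq> 0"
  shows
    "let M = from_coords e -` (ker_of A \<times> feas_dir A b C);
         N = from_coords e -` (ker_of A \<times> feas_dual A b C h);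
         N' = from_coords e -` (ker_of A \<times> uminus ` feas_dual A b C h);
         L = Lagr A b h c \<circ> from_coords e;
         \<Phi> = to_coords e \<circ> Leg_map A b h \<circ> from_coords e;
         H = Ham A b C h c \<circ> from_coords e;
         \<Phi>' = legendre_transform L;
         H' = hamiltonian_via \<Phi>' M L
     in
       (diffeo 1 \<Phi> M N \<and>
        (\<forall>z\<in>N. H z = hamiltonian_via \<Phi> M L z) \<and>
        completely_integrable 1 N H \<and>
        (Ck_on 2 \<Phi> M \<longrightarrow> diffeo 2 \<Phi> M N \<and> completely_integrable 2 N H)) \<and>
       (diffeo 1 \<Phi>' M N' \<and>
        (\<forall>(q, v)\<in>M. \<Phi>' (q, v) = (q, - snd (\<Phi> (q, v)))) \<and>
        (\<forall>z\<in>N'. H' z = Ham_L A b C h c (from_coords e z)) \<and>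
        (\<forall>T \<gamma>. open T \<and> is_interval T \<and> \<gamma> ` T \<subseteq> M \<longrightarrow>
           (lagrangian_trajectory L T \<gamma> \<longleftrightarrow> hamiltonian_trajectory H' T (\<Phi>' \<circ> \<gamma>))) \<and>
        completely_integrable 2 N' H')"
proof -
  define E :: "real^'r \<Rightarrow> real^'n" where "E = (\<lambda>v. \<Sum>i\<in>UNIV. v $ i *\<^sub>R e i)"
  define F :: "real^'n \<Rightarrow> real^'r" where "F = (\<lambda>x. \<chi> i. x \<bullet> e i)"
  note EF = orthonormal_coords[OF assms(9) E_def F_def]
  have fc: "from_coords e (q, v) = (E q, E v)" for q v by (simp add: from_coords_def E_def)
  have tc: "to_coords e (x, y) = (F x, F y)" for x y by (simp add: to_coords_def F_def)
  have bl: "bounded_linear E" "bounded_linear F"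
    using EF(1,2) by (simp_all add: linear_conv_bounded_linear)
  have E_inj: "E v = E w \<longleftrightarrow> v = w" for v w by (metis EF(4))
  obtain x0 where x0: "A *v x0 = b" using assms(3) by auto
  \<comment> \<open>Removing the kernel component of a solution leaves a solution orthogonal to the
    kernel. Then \<open>F\<close> inverts the parametrisation \<open>a + E v\<close> of the
    constraint, and both projections are expressed by the same \<open>E\<close> and
    \<open>F\<close>.\<close>
  define a where "a = x0 - E (F x0)"
  have ker: "A *v E v = 0" for v using EF(5) by (auto simp: ker_of_def)
  have Fa: "F a = 0" by (simp add: a_def linear_diff[OF EF(2)] EF(4))
  have Aa: "A *v a = b" by (simp add: a_def matrix_vector_mult_diff_distrib ker x0)
  have aff: "aff_of A b = range (\<lambda>v. a + E v)"
  proof (intro subset_antisym subsetI)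
    fix x assume "x \<in> aff_of A b"
    then have "x - a \<in> range E"
      unfolding EF(5) by (simp add: aff_of_def ker_of_def matrix_vector_mult_diff_distrib Aa)
    then obtain v where "x - a = E v" by blast
    then have "x = a + E v" by (simp add: algebra_simps)
    then show "x \<in> range (\<lambda>v. a + E v)" by blast
  qed (auto simp: aff_of_def matrix_vector_right_distrib Aa ker)
  have proj_ker: "proj_ker A y = E (F y)" for y
    using closest_point_affine[OF EF(1,2,3,4), of 0 y] linear_0[OF EF(2)] EF(5) by simp
  have proj_aff: "proj_aff A b y = a + E (F y)" for y
    unfolding aff by (rule closest_point_affine[OF EF(1,2,3,4) Fa])
  have Fa': "F (a + E v) = v" for v by (simp add: linear_add[OF EF(2)] Fa EF(4))

  \<comment> \<open>\<open>W\<close> is the feasible set in coordinates, and it also describes the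
    feasible directions since projecting drops \<open>a\<close>. \<open>F\<close> applied to the
    full gradient gives the coordinates of its kernel projection.\<close>
  define W where "W = {v. a + E v \<in> C}"
  define G where "G v = real_part h (a + E v)" for v
  define grad where "grad = gradient (real_part h)"
  define g where "g v = F (grad (a + E v))" for v
  have C2: "Ck_on (Suc 1) (real_part h) C"
    and pos: "\<And>x v. x \<in> C \<Longrightarrow> v \<noteq> 0 \<Longrightarrow> 0 < v \<bullet> (hessian (real_part h) x *v v)"
    using assms(8) by (auto simp: admissible_barrier_def numeral_2_eq_2 simp del: Ck_on.simps)
  have gradC1: "Ck_on 1 grad C" unfolding grad_def by (rule Ck_on_gradient[OF assms(5) C2])
  have shift_deriv: "((\<lambda>v. a + E v) has_derivative E) (at v)" for v
    using bounded_linear_imp_has_derivative[OF bl(1)] by (auto intro!: derivative_eq_intros)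
  have opnW: "open W"
    unfolding W_def
    using open_vimage[OF assms(5), of "\<lambda>v. a + E v"] bl(1)
    by (simp add: vimage_def continuous_on_add continuous_on_const linear_continuous_on)
  have shift_Ck: "Ck_on k (\<lambda>v. a + E v) W" for k
    by (rule Ck_on_add[OF opnW Ck_on_const[OF opnW] Ck_on_linear[OF opnW bl(1)]])
  interpret convex_gradient W G g
  proof
    show "open W" by (rule opnW)
    show "convex W"
      unfolding W_def
    proof (rule convexI, simp)
      fix v w and s t :: real
      assume "a + E v \<in> C" "a + E w \<in> C" and st: "0 \<le> s" "0 \<le> t" "s + t = 1"
      then have "s *\<^sub>R (a + E v) + t *\<^sub>R (a + E w) \<in> C" using convexD[OF assms(6)] by blast
      moreover have "s *\<^sub>R (a + E v) + t *\<^sub>R (a + E w) = (s + t) *\<^sub>R a + E (s *\<^sub>R v + t *\<^sub>R w)"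
        using EF(1) by (simp add: linear_add linear_scale algebra_simps)
      ultimately show "a + E (s *\<^sub>R v + t *\<^sub>R w) \<in> C" using st(3) by simp
    qed
    fix v assume "v \<in> W"
    then have v: "a + E v \<in> C" by (simp add: W_def)
    show "(G has_derivative (\<lambda>d. g v \<bullet> d)) (at v)"
      using has_derivative_compose[OF shift_deriv gradient_deriv(2)[OF Ck_on_SucD[OF C2 v]]]
      by (simp add: G_def[abs_def] g_def grad_def inner_commute[of _ "E _"] EF(3) inner_commute)
  next
    show "Ck_on 1 g W"
      unfolding g_def[abs_def]
      by (rule Ck_on_linear_comp[OF opnW bl(2) Ck_on_compose[OF opnW assms(5) gradC1 shift_Ck]])
        (auto simp: W_def)
  next
    fix v u :: "real^'r" assume "v \<in> W" and u: "u \<noteq> 0"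
    then have v: "a + E v \<in> C" by (simp add: W_def)
    let ?D = "frechet_derivative grad (at (a + E v))"
    have D: "(grad has_derivative ?D) (at (a + E v))"
      using Ck_on_SucD[of 0 grad] gradC1 v by simp
    have "(g has_derivative (\<lambda>d. F (?D (E d)))) (at v)"
      unfolding g_def[abs_def]
      by (rule bounded_linear.has_derivative[OF bl(2) has_derivative_compose[OF shift_deriv D]])
    \<comment> \<open>The derivative of \<open>g\<close> is \<open>F\<close>, the Hessian and
      \<open>E\<close> composed; adjointness moves \<open>F\<close> to the other side, leaving the
      quadratic form of the Hessian at \<open>E u\<close>, which is nonzero for nonzero
      \<open>u\<close>.\<close>
    then have "u \<bullet> frechet_derivative g (at v) u = E u \<bullet> ?D (E u)"
      by (simp add: frechet_derivative_eq EF(3))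
    also have "\<dots> = E u \<bullet> (hessian (real_part h) (a + E v) *v E u)"
      using has_derivative_linear[OF D] by (simp add: hessian_def grad_def)
    also have "\<dots> > 0" using pos[OF v] u E_inj[of u 0] linear_0[OF EF(1)] by simp
    finally show "0 < u \<bullet> frechet_derivative g (at v) u" .
  qed

  let ?M = "from_coords e -` (ker_of A \<times> feas_dir A b C)"
  let ?N = "from_coords e -` (ker_of A \<times> feas_dual A b C h)"
  let ?N' = "from_coords e -` (ker_of A \<times> uminus ` feas_dual A b C h)"
  let ?\<Phi> = "to_coords e \<circ> Leg_map A b h \<circ> from_coords e"
  let ?L = "Lagr A b h c \<circ> from_coords e" and ?H = "Ham A b C h c \<circ> from_coords e"
  \<comment> \<open>From here the sets and maps of the statement are rewritten through
    \<open>E\<close>, \<open>W\<close>, \<open>g\<close> and \<open>G\<close>, with \<kappa> =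
    \<open>F c\<close>, so that the coordinate results apply.\<close>
  have feas: "feas A b C = (\<lambda>v. a + E v) ` W" by (auto simp: feas_def aff W_def)
  have dir: "feas_dir A b C = E ` W"
    by (simp add: feas_dir_def feas image_image proj_ker Fa')
  have dual: "feas_dual A b C h = E ` g ` W"
    by (simp add: feas_dual_def feas image_image leg_coord_def proj_ker g_def grad_def)
  have E_ker: "E v \<in> ker_of A" for v using EF(5) by blast
  have M: "?M = UNIV \<times> W" by (auto simp: fc dir E_ker E_inj)
  have N: "?N = UNIV \<times> g ` W" by (auto simp: fc dual E_ker E_inj)
  have "uminus ` feas_dual A b C h = E ` (\<lambda>v. - g v) ` W"
    by (simp add: dual image_image linear_neg[OF EF(1)])
  then have N': "?N' = UNIV \<times> (\<lambda>v. - g v) ` W" by (auto simp: fc E_ker E_inj)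
  have phi: "phi_proj A b h (E v) = E (g v)" for v
    by (simp add: phi_proj_def leg_coord_def proj_aff proj_ker EF(4) g_def grad_def)
  have \<Phi>: "?\<Phi> = (\<lambda>(q, v). (q, g v))"
    by (auto simp: fun_eq_iff fc tc Leg_map_def phi EF(4))
  have L: "?L = (\<lambda>(q, v). F c \<bullet> q - G v)"
    by (auto simp: fun_eq_iff fc Lagr_def proj_ker proj_aff EF(3,4) G_def)
  have \<kappa>: "F c \<noteq> 0" using assms(10) linear_0[OF EF(1)] by (auto simp: proj_ker)
  have phi_inj: "inj_on (phi_proj A b h) (feas_dir A b C)"
    unfolding dir by (auto simp: inj_on_def phi E_inj dest: inj_onD[OF g_inj])
  have phi_inv: "phi_proj_inv A b C h (E (g w)) = E w" if "w \<in> W" for w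
    unfolding phi_proj_inv_def by (rule inv_into_f_eq[OF phi_inj]) (use that in \<open>auto simp: dir phi\<close>)
  have H: "?H (q, p) = p \<bullet> inv_into W g p - ?L (q, inv_into W g p)" if "p \<in> g ` W" for q p
    using that by (auto simp: fc Ham_def phi_inv g_inj EF(3,4))
  note ham = hamiltonian_side[where H = ?H, OF \<kappa> L \<Phi> H]
  note lag = lagrangian_side[OF \<kappa> L]
  have leg: "\<forall>(q, v)\<in>UNIV \<times> W. legendre_transform ?L (q, v) = (q, - snd (?\<Phi> (q, v)))"
    using legendre_transform_L[OF \<kappa> L] by (simp add: \<Phi> del: o_apply)
  have ham_L: "\<forall>z\<in>(UNIV :: (real^'r) set) \<times> (\<lambda>v. - g v) ` W.
      hamiltonian_via (legendre_transform ?L) (UNIV \<times> W) ?L z = Ham_L A b C h c (from_coords e z)"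
  proof
    fix z :: "'r phase" assume "z \<in> UNIV \<times> (\<lambda>v. - g v) ` W"
    then obtain q w where w: "z = (q, - g w)" "w \<in> W" by auto
    \<comment> \<open>The sign flip inside \<open>Ham_L\<close> undoes the minus sign of the
      momentum, so \<open>phi_proj_inv\<close> is evaluated at \<open>E (g w)\<close>, where it is
      known.\<close>
    have "- E (- g w) = E (g w)" by (simp add: linear_neg[OF EF(1)])
    moreover have "inv_into W (\<lambda>v. - g v) (- g w) = w"
      using inv_into_f_f[OF uminus_g(1) w(2)] .
    ultimately show "hamiltonian_via (legendre_transform ?L) (UNIV \<times> W) ?L z =
        Ham_L A b C h c (from_coords e z)"
      using lag(2)[of "- g w" q] w by (simp add: fc Ham_L_def phi_inv EF(3,4))
  qed
  have traj: "\<forall>T \<gamma>. open T \<and> is_interval T \<and> \<gamma> ` T \<subseteq> UNIV \<times> W \<longrightarrow>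
      (lagrangian_trajectory ?L T \<gamma> \<longleftrightarrow> hamiltonian_trajectory
        (hamiltonian_via (legendre_transform ?L) (UNIV \<times> W) ?L) T (legendre_transform ?L \<circ> \<gamma>))"
    using lag(3) by blast
  have smooth: "Ck_on 2 ?\<Phi> (UNIV \<times> W) \<longrightarrow>
      diffeo 2 ?\<Phi> (UNIV \<times> W) (UNIV \<times> g ` W) \<and> completely_integrable 2 (UNIV \<times> g ` W) ?H"
    using ham(4) by blast
  show ?thesis
    unfolding Let_def M N N'
    by (intro conjI ham(1-3) smooth lag(1) leg ham_L traj lag(4))
qed

end
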